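(* Let $\mathbb{S}$ be a (two-dimensional) surface in $B(0,1/2)\subset\mathbb{R}^3$, the ball of radius $1/2$ centered at the origin, and suppose that for a fixed $K$ the points $\{p_i, 1\le i\le N\}$ are quasi-uniform samples of $K\mathbb{S}=\{K\cdot p\mid p\in\mathbb{S}\}$, where $N$ is of order $K^2$. Consider the parallel directional fast multipole algorithm (described in the context) run on $p$ processes, and suppose that each process is assigned the same number of directions, i.e. the number of pairs $(B,\ell)$, with $B$ a nonempty box with $1\le w(B)\le\sqrt{K}$ assigned to the process and $\ell$ a direction of $B$, is the same for every process. Then the HF-M2M, HF-M2L, and HF-L2L translations have computational complexity $O(N\log N/p)$; that is, the maximum over processes of the number of operations spent on these translations is $O(N\log N/p)$.
   Context: Problem: given densities $f_i$ at points $p_i\in\mathbb{R}^3$, $|p_i|\le K/2$, compute to a fixed accuracy $\epsilon$ the potentials $u_i=\sum_{j=1}^N G(p_i,p_j)f_j$, where $G(x,y)=e^{2\pi\iota|x-y|}/|x-y|$. Here $K=2^{2L}$ with $L$ a positive integer. $\mathbb{S}$ is a fixed two-dimensional manifold, and quasi-uniform means that the fill distance of $\{p_i\}$ in $K\mathbb{S}$ is at most a fixed constant times the minimal distance between distinct sample points. Implied constants may depend on $\epsilon$, $\mathbb{S}$ and the sampling constants, but not on $K,N,p$ or the partition. Octree: the root is the cube of width $K$ centered at the origin; level-$l$ boxes are cubes of width $K2^{-l}$. $w(B)$ is the width of $B$. A box is nonempty if it contains some $p_i$; only nonempty boxes require computation. A box with $w(B)\ge1$ (high-frequency regime) is subdivided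 into 8 children iff nonempty. Interaction lists and directions: for a box $B$ with center $c$ and $w(B)=w\ge1$, the near field $N^B$ is the set of boxes containing a point $x$ with $|x-c|\le3w^2/4$. With $P$ the parent of $B$, the interaction list $I^B$ is $N^P\setminus N^B$, i.e. the set of nonempty boxes $A$ with $w(A)=w(B)$ whose parent is in $N^P$ and which are not in $N^B$. The far field of $B$ (complement of $N^B$) is partitioned into a number of order $w^2$ of wedges of spanning angle $O(1/w)$, called the directions $\ell$ of $B$; each $A\in I^B$ is assigned to exactly one direction of $B$. The wedges are hierarchical: for each direction $\ell$ of $B$ there is a direction $\ell'$ of the boxes of width $w/2$ such that the $\ell$-th wedge of $B$ is contained in the $\ell'$-th wedge of each child of $B$. Partition: a map $\mathcal{P}$ assigns a process in $\{0,\dots,p-1\}$ to each nonempty box of width $\sqrt{K}$; each descendant box inherits the process of its ancestor of width $\sqrt{K}$. Process $q$ performs all computations, for all directions, for the boxes $B$ with $\mathcal{P}(B)=q$, and all processes compute simultaneously. Computation and communication are not overlapped, and communication is not counted here. High-frequency translations, performed for every nonempty box $B$ with $1\le w(B)\le\sqrt{K}$ and every direction $\ell$ of $B$: HF-M2M constructs the outgoing directional equivalent charges of $B$ in direction $\ell$ from the outgoing equivalent charges of its (at most 8) children in direction $\ell'$; HF-M2L adds to the incoming directional check potentials of $B$ in direction $\ell$ a contribution from the outgoing directional equivalent charges of each $A\in I^B$ lying in direction $\ell$; HF-L2L constructs incoming check potentials of the children of $B$ from those of $B$ in direction $\ell$. All these vectors have length bounded by a constant depending only on $\epsilon$, and each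 single translation (one child or one interaction-list box, for one direction) costs $O(1)$ operations. *)

theory Defs
  imports "HOL-Analysis.Analysis"
begin

section \<open>Surfaces and samples\<close>

(* A compact two-dimensional Lipschitz submanifold of R^3, possibly with boundary: locally
   bi-Lipschitz to a relatively open piece of the closed half-plane (such a piece may avoid the
   edge, so interior points are covered). Every compact embedded C^1 surface is of this kind, and
   so are piecewise smooth ones. Some such regularity is indispensable: a merely topological or
   a non-compact surface can have infinite area, and then O(K^2) boxes of unit width do not
   suffice to cover its K-fold dilation. *)
definition surface :: "(real^3) set \<Rightarrow> bool" where
  "surface S \<longleftrightarrow> compact S \<and>
     (\<forall>x\<in>S. \<exists>U V (\<phi> :: real^3 \<Rightarrow> real^2) \<psi> M.
        openin (top_of_set S) U \<and> x \<in> U \<and> openin (top_of_set {z :: real^2. 0 \<le> z $ 1}) V \<and>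
        homeomorphism U V \<phi> \<psi> \<and> M-lipschitz_on U \<phi> \<and> M-lipschitz_on V \<psi>)"

definition fill_distance :: "(real^3) set \<Rightarrow> (real^3) set \<Rightarrow> real" where
  "fill_distance X Y = (SUP y\<in>Y. infdist y X)"

definition quasi_uniform :: "real \<Rightarrow> (real^3) set \<Rightarrow> (real^3) set \<Rightarrow> bool" where
  "quasi_uniform \<gamma> X Y \<longleftrightarrow> finite X \<and> X \<subseteq> Y \<and>
     (\<forall>x\<in>X. \<forall>y\<in>X. x \<noteq> y \<longrightarrow> fill_distance X Y \<le> \<gamma> * dist x y)"

section \<open>Octree\<close>

datatype obox = OBox (centre: "real^3") (width: real)

(* Cubes are closed, so a sample on a common face is contained in every cube sharing it. *)
definition cube :: "obox \<Rightarrow> (real^3) set" where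
  "cube B = cbox (centre B - vec (width B / 2)) (centre B + vec (width B / 2))"

definition root_box :: "real \<Rightarrow> obox" where
  "root_box K = OBox 0 K"

definition children :: "obox \<Rightarrow> obox set" where
  "children B = {OBox (centre B + (width B / 4) *\<^sub>R s) (width B / 2) | s. \<forall>i. s $ i = 1 \<or> s $ i = -1}"

primrec level_boxes :: "real \<Rightarrow> nat \<Rightarrow> obox set" where
  "level_boxes K 0 = {root_box K}"
| "level_boxes K (Suc l) = (\<Union>B\<in>level_boxes K l. children B)"

(* All cubes of all levels, including those that the adaptive octree below never creates. *)
definition all_boxes :: "real \<Rightarrow> obox set" where
  "all_boxes K = (\<Union>l. level_boxes K l)"

definition nonempty_box :: "(real^3) set \<Rightarrow> obox \<Rightarrow> bool" where
  "nonempty_box X B \<longleftrightarrow> X \<inter> cube B \<noteq> {}"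

(* Only the high-frequency part of the octree: boxes of width below 1 are not subdivided here,
   since their treatment does not concern the high-frequency translations. *)
inductive_set octree :: "real \<Rightarrow> (real^3) set \<Rightarrow> obox set" for K X where
  root: "root_box K \<in> octree K X"
| child: "\<lbrakk>B \<in> octree K X; 1 \<le> width B; nonempty_box X B; C \<in> children B\<rbrakk> \<Longrightarrow> C \<in> octree K X"

definition hf_boxes :: "real \<Rightarrow> (real^3) set \<Rightarrow> obox set" where
  "hf_boxes K X = {B \<in> octree K X. nonempty_box X B \<and> 1 \<le> width B \<and> width B \<le> sqrt K}"

section \<open>Near field, interaction list, directions\<close>

(* Consists of boxes of the same width as B; empty boxes count, so that the complement of the near
   field really stays away from B. *)
definition near_field :: "real \<Rightarrow> obox \<Rightarrow> obox set" where
  "near_field K B = {A \<in> all_boxes K. width A = width B \<and>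
     (\<exists>x\<in>cube A. dist x (centre B) \<le> 3 * (width B)\<^sup>2 / 4)}"

definition interaction_list :: "real \<Rightarrow> (real^3) set \<Rightarrow> obox \<Rightarrow> obox set" where
  "interaction_list K X B = {A \<in> octree K X. nonempty_box X A \<and> width A = width B \<and>
     (\<exists>P Q. P \<in> octree K X \<and> B \<in> children P \<and> Q \<in> near_field K P \<and> A \<in> children Q) \<and>
     A \<notin> near_field K B}"

definition far_field :: "real \<Rightarrow> obox \<Rightarrow> (real^3) set" where
  "far_field K B = cube (root_box K) - (\<Union>A\<in>near_field K B. cube A)"

definition vec_angle :: "real^3 \<Rightarrow> real^3 \<Rightarrow> real" where
  "vec_angle u v = arccos (u \<bullet> v / (norm u * norm v))"

(* D B is the set of (labels of) directions of B and W B l is its l-th wedge. A wedge may be empty,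
   as happens when the whole root cube lies on one side of B. *)
definition direction_system ::
    "real \<Rightarrow> real \<Rightarrow> real \<Rightarrow> real \<Rightarrow> (obox \<Rightarrow> nat set) \<Rightarrow> (obox \<Rightarrow> nat \<Rightarrow> (real^3) set) \<Rightarrow> bool" where
  "direction_system d\<^sub>1 d\<^sub>2 \<alpha> K D W \<longleftrightarrow>
     (\<forall>B \<in> all_boxes K. 1 \<le> width B \<and> width B \<le> sqrt K \<longrightarrow>
        finite (D B) \<and>
        d\<^sub>1 * (width B)\<^sup>2 \<le> real (card (D B)) \<and> real (card (D B)) \<le> d\<^sub>2 * (width B)\<^sup>2 \<and>
        disjoint_family_on (W B) (D B) \<and> (\<Union>l\<in>D B. W B l) = far_field K B \<and>
        (\<forall>l\<in>D B. \<forall>x\<in>W B l. \<forall>y\<in>W B l. vec_angle (x - centre B) (y - centre B) \<le> \<alpha> / width B) \<and>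
        (1 \<le> width B / 2 \<longrightarrow>
           (\<forall>l\<in>D B. \<exists>l'. \<forall>C\<in>children B. l' \<in> D C \<and> W B l \<subseteq> W C l')))"

(* dir B A is the direction of B to which the interaction-list box A is assigned. A box may meet
   several wedges; any one of them may be chosen. *)
definition direction_assignment ::
    "real \<Rightarrow> (real^3) set \<Rightarrow> (obox \<Rightarrow> nat set) \<Rightarrow> (obox \<Rightarrow> nat \<Rightarrow> (real^3) set) \<Rightarrow>
     (obox \<Rightarrow> obox \<Rightarrow> nat) \<Rightarrow> bool" where
  "direction_assignment K X D W dir \<longleftrightarrow>
     (\<forall>B \<in> hf_boxes K X. \<forall>A \<in> interaction_list K X B.
        dir B A \<in> D B \<and> cube A \<inter> W B (dir B A) \<noteq> {})"

section \<open>Partition among processes and operation counts\<close>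

definition process_partition :: "real \<Rightarrow> (real^3) set \<Rightarrow> nat \<Rightarrow> (obox \<Rightarrow> nat) \<Rightarrow> bool" where
  "process_partition K X p \<P> \<longleftrightarrow>
     (\<forall>B \<in> hf_boxes K X. width B = sqrt K \<longrightarrow> \<P> B < p) \<and>
     (\<forall>B \<in> hf_boxes K X. \<forall>C \<in> children B \<inter> hf_boxes K X. \<P> C = \<P> B)"

definition process_directions ::
    "real \<Rightarrow> (real^3) set \<Rightarrow> (obox \<Rightarrow> nat set) \<Rightarrow> (obox \<Rightarrow> nat) \<Rightarrow> nat \<Rightarrow> (obox \<times> nat) set" where
  "process_directions K X D \<P> q = {(B, l). B \<in> hf_boxes K X \<and> \<P> B = q \<and> l \<in> D B}"

(* m2m B l C, m2l B l A and l2l B l C are the numbers of operations of the single translations from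
   the child C to B, from the interaction-list box A to B, and from B to the child C, for the
   direction l of B. *)
definition hf_operations ::
    "real \<Rightarrow> (real^3) set \<Rightarrow> (obox \<Rightarrow> nat set) \<Rightarrow> (obox \<Rightarrow> obox \<Rightarrow> nat) \<Rightarrow> (obox \<Rightarrow> nat) \<Rightarrow>
     (obox \<Rightarrow> nat \<Rightarrow> obox \<Rightarrow> nat) \<Rightarrow> (obox \<Rightarrow> nat \<Rightarrow> obox \<Rightarrow> nat) \<Rightarrow> (obox \<Rightarrow> nat \<Rightarrow> obox \<Rightarrow> nat) \<Rightarrow>
     nat \<Rightarrow> nat" where
  "hf_operations K X D dir \<P> m2m m2l l2l q =
     (\<Sum>(B, l)\<in>process_directions K X D \<P> q.
        (\<Sum>C\<in>{C \<in> children B. nonempty_box X C}. m2m B l C) +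
        (\<Sum>A\<in>{A \<in> interaction_list K X B. dir B A = l}. m2l B l A) +
        (\<Sum>C\<in>{C \<in> children B. nonempty_box X C}. l2l B l C))"

end

theory Submission
  imports Defs
begin

text \<open>
The translations of a single pair of a box and a direction need not have bounded cost: where the
surface runs along a wedge, that wedge can contain many boxes of the interaction list. What is
bounded is the average over the directions of one box, and this suffices because all directions of
a box belong to the same process.

Both halves of the argument rest on the two-dimensionality of \<open>S\<close>, in the form of
\<open>surface_box_count\<close>: within distance \<open>R\<close> of any point, at most \<open>O((R/w)\<^sup>2)\<close> grid cubes of width \<open>w\<close>
with \<open>w \<le> R\<close> meet the dilated surface.

With \<open>R = O(w\<^sup>2)\<close> it shows that the interaction list of a box of width \<open>w\<close> has \<open>O(w\<^sup>2)\<close> members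
(\<open>interaction_list_count\<close>). The box has at least \<open>d\<^sub>1 w\<^sup>2\<close> directions, so its M2L work is
at most a constant times its number of directions; as a box has at most eight children, the same
holds for its M2M and L2L work. Hence the work of a process is at most a constant times its number
of pairs
(\<open>hf_operations_le_process_directions\<close>).

With \<open>R = K\<close> it shows that \<open>O((K/w)\<^sup>2)\<close> boxes of width \<open>w\<close> are nonempty. Each of them has \<open>O(w\<^sup>2)\<close>
directions, so every level contributes \<open>O(K\<^sup>2)\<close> pairs and the \<open>O(L)\<close> levels together contribute
\<open>O(K\<^sup>2 L)\<close> (\<open>direction_system_count\<close>). Since \<open>N\<close> is of order \<open>K\<^sup>2 = 2\<^bsup>4L\<^esup>\<close>, this is
\<open>O(N log N)\<close> (\<open>levels_le_ln\<close>), and equal shares give each process a fraction \<open>1/p\<close> of it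
(\<open>equal_share_of_directions\<close>).
\<close>

section \<open>Geometry of the octree\<close>

lemma finite_card_children: "finite (children B) \<and> card (children B) \<le> 8"
proof -
  let ?V = "{s :: real^3. \<forall>i. s $ i = 1 \<or> s $ i = -1}"
  have inj: "inj_on (\<lambda>s :: real^3. {i. s $ i = 1}) ?V"
  proof (rule inj_onI)
    fix s t :: "real^3"
    assume s: "s \<in> ?V" and t: "t \<in> ?V" and eq: "{i. s $ i = 1} = {i. t $ i = 1}"
    have "s $ i = t $ i" for i
    proof -
      have "s $ i = 1 \<or> s $ i = -1" "t $ i = 1 \<or> t $ i = -1" using s t by blast+
      moreover have "s $ i = 1 \<longleftrightarrow> t $ i = 1" using eq by blast
      ultimately show ?thesis by metis
    qed
    then show "s = t" by (simp add: vec_eq_iff)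
  qed
  have fin: "finite ?V"
    using inj by (rule inj_on_finite[of _ _ UNIV]) auto
  have "card ?V \<le> card (UNIV :: 3 set set)"
    using inj by (rule card_inj_on_le) auto
  then have "card ?V \<le> 8"
    by (simp add: card_UNIV_set)
  moreover have "children B = (\<lambda>s. OBox (centre B + (width B / 4) *\<^sub>R s) (width B / 2)) ` ?V"
    by (auto simp: children_def)
  ultimately show ?thesis
    using fin card_image_le[OF fin] by (metis (no_types, lifting) finite_imageI le_trans)
qed

lemma finite_level_boxes: "finite (level_boxes K l)"
  by (induction l) (auto simp: finite_card_children)

lemma width_level_boxes: "B \<in> level_boxes K l \<Longrightarrow> width B = K / 2 ^ l"
  by (induction l arbitrary: B) (auto simp: root_box_def children_def)

text \<open>The centres of one level form part of a translated cubic lattice: passing to children moves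
each centre by a quarter of the width in each coordinate, so two displacements differ by zero or by
one full child width.\<close>

lemma level_boxes_grid:
  assumes "A \<in> level_boxes K l" and "B \<in> level_boxes K l"
  shows "\<exists>z :: int. centre A $ i - centre B $ i = of_int z * (K / 2 ^ l)"
  using assms
proof (induction l arbitrary: A B)
  case 0
  then show ?case by (auto intro: exI[of _ 0])
next
  case (Suc l)
  obtain P s where P: "P \<in> level_boxes K l" "\<forall>i. s $ i = 1 \<or> s $ i = -1"
    "A = OBox (centre P + (width P / 4) *\<^sub>R s) (width P / 2)"
    using Suc.prems(1) by (auto simp: children_def)
  obtain Q t where Q: "Q \<in> level_boxes K l" "\<forall>i. t $ i = 1 \<or> t $ i = -1"
    "B = OBox (centre Q + (width Q / 4) *\<^sub>R t) (width Q / 2)"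
    using Suc.prems(2) by (auto simp: children_def)
  obtain z :: int where z: "centre P $ i - centre Q $ i = of_int z * (K / 2 ^ l)"
    using Suc.IH[OF P(1) Q(1)] by blast
  have "\<exists>k :: int. s $ i - t $ i = 2 * of_int k"
    using P(2)[rule_format, of i] Q(2)[rule_format, of i]
    by (auto intro: exI[of _ 0] exI[of _ 1] exI[of _ "-1"])
  then obtain k :: int where k: "s $ i - t $ i = 2 * of_int k" by blast
  have "centre A $ i - centre B $ i = (centre P $ i - centre Q $ i) + (K / 2 ^ l / 4) * (s $ i - t $ i)"
    by (simp add: P(3) Q(3) width_level_boxes[OF P(1)] width_level_boxes[OF Q(1)] algebra_simps diff_divide_distrib)
  also have "\<dots> = of_int (2 * z + k) * (K / 2 ^ Suc l)"
    unfolding z k by (simp add: field_simps)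
  finally show ?case by blast
qed

lemma octree_subset_all_boxes: "octree K X \<subseteq> all_boxes K"
proof
  fix B assume "B \<in> octree K X"
  then show "B \<in> all_boxes K"
  proof induction
    case root
    show ?case unfolding all_boxes_def by (auto intro: exI[of _ 0])
  next
    case (child B C)
    then obtain l where "B \<in> level_boxes K l" by (auto simp: all_boxes_def)
    then have "C \<in> level_boxes K (Suc l)" using child by auto
    then show ?case unfolding all_boxes_def by blast
  qed
qed

lemma mem_cube: "x \<in> cube B \<longleftrightarrow> (\<forall>i. \<bar>x $ i - centre B $ i\<bar> \<le> width B / 2)"
proof -
  have "x \<in> cube B \<longleftrightarrow> (\<forall>i. centre B $ i - width B / 2 \<le> x $ i \<and> x $ i \<le> centre B $ i + width B / 2)"
    by (simp add: cube_def mem_box_cart vec_def)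
  moreover have "centre B $ i - width B / 2 \<le> x $ i \<and> x $ i \<le> centre B $ i + width B / 2
      \<longleftrightarrow> \<bar>x $ i - centre B $ i\<bar> \<le> width B / 2" for i
    by linarith
  ultimately show ?thesis by simp
qed

lemma child_cube_subset:
  assumes "C \<in> children B" and "0 \<le> width B"
  shows "cube C \<subseteq> cube B"
proof
  fix x assume x: "x \<in> cube C"
  obtain s where s: "\<forall>i. s $ i = 1 \<or> s $ i = -1"
    "C = OBox (centre B + (width B / 4) *\<^sub>R s) (width B / 2)"
    using assms(1) by (auto simp: children_def)
  have "\<bar>x $ i - centre B $ i\<bar> \<le> width B / 2" for i
  proof -
    have "\<bar>x $ i - (centre B $ i + width B / 4 * s $ i)\<bar> \<le> width B / 4"
      using x[unfolded mem_cube, rule_format, of i] by (simp add: s(2))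
    moreover have "\<bar>width B / 4 * s $ i\<bar> \<le> width B / 4"
      using s(1)[rule_format, of i] assms(2) by auto
    ultimately show ?thesis by linarith
  qed
  then show "x \<in> cube B" by (simp add: mem_cube)
qed

lemma norm_le_three_times:
  fixes v :: "real^3"
  assumes "\<And>i. \<bar>v $ i\<bar> \<le> t"
  shows "norm v \<le> 3 * t"
proof -
  have "norm v \<le> (\<Sum>i\<in>UNIV. \<bar>v $ i\<bar>)" by (rule norm_le_l1_cart)
  also have "\<dots> \<le> (\<Sum>i\<in>(UNIV :: 3 set). t)" using assms by (rule sum_mono)
  also have "\<dots> = 3 * t" by simp
  finally show ?thesis .
qed

section \<open>Counting boxes that meet a surface\<close>

text \<open>Bounds on the distortion of distances, rather than a pair of mutually inverse Lipschitz maps,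
so that \<open>M\<close> can be enlarged freely when finitely many charts are merged.\<close>

definition planar_bilipschitz :: "real \<Rightarrow> (real^3) set \<Rightarrow> bool" where
  "planar_bilipschitz M U \<longleftrightarrow> (\<exists>\<phi> :: real^3 \<Rightarrow> real^2. \<forall>u\<in>U. \<forall>v\<in>U.
     dist (\<phi> u) (\<phi> v) \<le> M * dist u v \<and> dist u v \<le> M * dist (\<phi> u) (\<phi> v))"

lemma planar_bilipschitz_mono:
  assumes "planar_bilipschitz m U" and "m \<le> M"
  shows "planar_bilipschitz M U"
proof -
  obtain \<phi> :: "real^3 \<Rightarrow> real^2" where \<phi>: "\<forall>u\<in>U. \<forall>v\<in>U.
      dist (\<phi> u) (\<phi> v) \<le> m * dist u v \<and> dist u v \<le> m * dist (\<phi> u) (\<phi> v)"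
    using assms(1) unfolding planar_bilipschitz_def by blast
  have "dist (\<phi> u) (\<phi> v) \<le> M * dist u v \<and> dist u v \<le> M * dist (\<phi> u) (\<phi> v)"
    if "u \<in> U" "v \<in> U" for u v
    using \<phi>[rule_format, OF that] mult_right_mono[OF assms(2), of "dist u v"]
      mult_right_mono[OF assms(2), of "dist (\<phi> u) (\<phi> v)"] by simp
  then show ?thesis
    unfolding planar_bilipschitz_def by (intro exI[of _ \<phi>]) simp
qed

text \<open>Compactness turns the local charts into finitely many, so that one Lipschitz constant serves
all of them.\<close>

lemma surface_bilipschitz_cover:
  assumes "surface S"
  obtains \<U> :: "(real^3) set set" and M :: real where "finite \<U>" and "S \<subseteq> \<Union>\<U>" and "1 \<le> M"
    and "\<And>U. U \<in> \<U> \<Longrightarrow> planar_bilipschitz M U"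
proof -
  define \<C> where "\<C> = {U. openin (top_of_set S) U \<and> (\<exists>M. planar_bilipschitz M U)}"
  have chart: "\<exists>U\<in>\<C>. x \<in> U" if xS: "x \<in> S" for x
  proof -
    obtain U V and \<phi> :: "real^3 \<Rightarrow> real^2" and \<psi> M where
      *: "openin (top_of_set S) U" "x \<in> U" "homeomorphism U V \<phi> \<psi>"
        "M-lipschitz_on U \<phi>" "M-lipschitz_on V \<psi>"
      using bspec[OF conjunct2[OF assms[unfolded surface_def]] xS]
      by (elim exE conjE) (rule that, assumption+)
    have "dist (\<phi> u) (\<phi> v) \<le> M * dist u v \<and> dist u v \<le> M * dist (\<phi> u) (\<phi> v)"
      if "u \<in> U" "v \<in> U" for u v
    proof -
      have "\<phi> u \<in> V" "\<phi> v \<in> V" "\<psi> (\<phi> u) = u" "\<psi> (\<phi> v) = v"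
        using *(3) that by (auto simp: homeomorphism_def)
      then show ?thesis
        using lipschitz_onD[OF *(4) that] lipschitz_onD[OF *(5), of "\<phi> u" "\<phi> v"] by simp
    qed
    then have "planar_bilipschitz M U"
      unfolding planar_bilipschitz_def by (intro exI[of _ \<phi>]) simp
    then show ?thesis using *(1,2) unfolding \<C>_def by blast
  qed
  have "compact S" using assms by (simp add: surface_def)
  moreover have "\<forall>c\<in>\<C>. openin (top_of_set S) c" by (simp add: \<C>_def)
  moreover have "S \<subseteq> \<Union>\<C>" using chart by blast
  ultimately obtain \<U> where \<U>: "\<U> \<subseteq> \<C>" "finite \<U>" "S \<subseteq> \<Union>\<U>"
    unfolding compact_eq_openin_cover by meson
  have "\<forall>U\<in>\<U>. \<exists>M. planar_bilipschitz M U" using \<U>(1) by (auto simp: \<C>_def)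
  then obtain m where m: "\<And>U. U \<in> \<U> \<Longrightarrow> planar_bilipschitz (m U) U" by metis
  define M where "M = Max (insert 1 (m ` \<U>))"
  have "1 \<le> M" using \<U>(2) by (simp add: M_def)
  moreover have "m U \<le> M" if "U \<in> \<U>" for U
    using \<U>(2) that by (simp add: M_def)
  then have "planar_bilipschitz M U" if "U \<in> \<U>" for U
    using m that planar_bilipschitz_mono by blast
  ultimately show ?thesis using that \<U>(2,3) by blast
qed

text \<open>
A packing argument in the plane. Pick a point of the surface in every box and cut the plane into
square cells that are so small that points in the same cell come from points of the dilated surface
at distance less than \<open>w\<close>. The centres of two boxes with the same cell are then less than \<open>2w\<close> apart in
each coordinate, so by \<open>level_boxes_grid\<close> their lattice coordinates differ by at most one, and the
parities of these coordinates tell the boxes apart. Thus there are at most eight boxes per cell, and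
the images of the chosen points lie in a square of \<open>O(R/w)\<close> by \<open>O(R/w)\<close> cells.
\<close>

lemma bilipschitz_piece_box_count:
  assumes "1 \<le> M" and "0 < K" and w: "w = K / 2 ^ l" and "w \<le> R"
    and piece: "planar_bilipschitz M U"
    and lev: "\<A> \<subseteq> level_boxes K l"
    and meets: "\<forall>A\<in>\<A>. \<exists>u\<in>U. K *\<^sub>R u \<in> cube A \<and> dist (K *\<^sub>R u) y \<le> R"
  shows "real (card \<A>) \<le> 968 * (M\<^sup>2 * (R / w))\<^sup>2"
proof (cases "\<A> = {}")
  case False
  then obtain A\<^sub>0 where A0: "A\<^sub>0 \<in> \<A>" by blast
  obtain \<phi> :: "real^3 \<Rightarrow> real^2" where bl: "\<forall>u\<in>U. \<forall>v\<in>U.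
      dist (\<phi> u) (\<phi> v) \<le> M * dist u v \<and> dist u v \<le> M * dist (\<phi> u) (\<phi> v)"
    using piece unfolding planar_bilipschitz_def by blast
  have "0 < w" using assms by simp
  obtain u where u: "\<And>A. A \<in> \<A> \<Longrightarrow> u A \<in> U \<and> K *\<^sub>R u A \<in> cube A \<and> dist (K *\<^sub>R u A) y \<le> R"
    using meets by metis
  have scale: "dist (K *\<^sub>R a) (K *\<^sub>R b) = K * dist a b" for a b :: "real^3"
    using assms(2) by (simp add: dist_norm flip: scaleR_diff_right)
  \<comment> \<open>Two points in a cell have images at distance less than \<open>2\<delta>\<close>, hence preimages at distance less
    than \<open>2M\<delta> = w/K\<close>, which the dilation stretches to \<open>w\<close>.\<close>
  define \<delta> where "\<delta> = w / (2 * M * K)"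
  have "0 < \<delta>" using \<open>0 < w\<close> assms(1,2) by (simp add: \<delta>_def)
  define T where "T = 4 * (M\<^sup>2 * (R / w))"
  define cell where "cell A i = \<lfloor>(\<phi> (u A) $ i - \<phi> (u A\<^sub>0) $ i) / \<delta>\<rfloor>" for A i
  define z where "z A i = \<lfloor>(centre A $ i - centre A\<^sub>0 $ i) / w\<rfloor>" for A i
  have z: "centre A $ i - centre A\<^sub>0 $ i = of_int (z A i) * w" if A: "A \<in> \<A>" for A i
  proof -
    obtain k :: int where "centre A $ i - centre A\<^sub>0 $ i = of_int k * (K / 2 ^ l)"
      using level_boxes_grid lev A A0 by blast
    then show ?thesis using \<open>0 < w\<close> by (simp add: z_def w[symmetric])
  qed
  define code where "code A = (cell A 1, cell A 2, {i. even (z A i)})" for A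
  define I where "I = {-\<lceil>T\<rceil>..\<lceil>T\<rceil>}"
  have "inj_on code \<A>"
  proof (rule inj_onI)
    fix A B assume AB: "A \<in> \<A>" "B \<in> \<A>" and eq: "code A = code B"
    have "\<bar>(\<phi> (u A) - \<phi> (u B)) $ i\<bar> < \<delta>" for i
    proof -
      have "cell A i = cell B i" using eq exhaust_2[of i] by (auto simp: code_def)
      then have "\<bar>(\<phi> (u A) $ i - \<phi> (u A\<^sub>0) $ i) / \<delta> - (\<phi> (u B) $ i - \<phi> (u A\<^sub>0) $ i) / \<delta>\<bar> < 1"
        unfolding cell_def by linarith
      then have "\<bar>((\<phi> (u A) - \<phi> (u B)) $ i) / \<delta>\<bar> < 1"
        by (simp add: diff_divide_distrib)
      then show ?thesis using \<open>0 < \<delta>\<close> by (simp add: abs_divide)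
    qed
    from this[of 1] this[of 2] have "dist (\<phi> (u A)) (\<phi> (u B)) < 2 * \<delta>"
      using norm_le_l1_cart[of "\<phi> (u A) - \<phi> (u B)"] unfolding dist_norm sum_2 by linarith
    then have "M * dist (\<phi> (u A)) (\<phi> (u B)) < M * (2 * \<delta>)"
      using assms(1) by simp
    then have "dist (u A) (u B) < w / K"
      using bl u AB assms(1) by (simp add: \<delta>_def) (smt (verit))
    then have "norm (K *\<^sub>R u A - K *\<^sub>R u B) < w"
      using assms(2) scale[of "u A" "u B"] by (simp add: dist_norm pos_less_divide_eq mult.commute)
    then have *: "\<bar>(K *\<^sub>R u A) $ i - (K *\<^sub>R u B) $ i\<bar> < w" for i
      using component_le_norm_cart[of "K *\<^sub>R u A - K *\<^sub>R u B" i]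
      unfolding vector_minus_component by (rule le_less_trans[rotated])
    have wAB: "width A = w" "width B = w"
      using width_level_boxes lev AB w by blast+
    have "centre A $ i = centre B $ i" for i
    proof -
      have "\<bar>(K *\<^sub>R u A) $ i - centre A $ i\<bar> \<le> w / 2" "\<bar>(K *\<^sub>R u B) $ i - centre B $ i\<bar> \<le> w / 2"
        using u[OF AB(1)] u[OF AB(2)] wAB unfolding mem_cube by (metis, metis)
      then have "\<bar>centre A $ i - centre B $ i\<bar> < 2 * w"
        using *[of i] by linarith
      moreover have zz: "centre A $ i - centre B $ i = of_int (z A i - z B i) * w"
        using z[OF AB(1), of i] z[OF AB(2), of i] by (simp add: algebra_simps)
      ultimately have "\<bar>z A i - z B i\<bar> < 2"
        using \<open>0 < w\<close> by (simp add: abs_mult)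
      moreover have "even (z A i) = even (z B i)"
        using eq by (auto simp: code_def set_eq_iff)
      ultimately have "z A i = z B i" by presburger
      then show ?thesis using zz by simp
    qed
    then show "A = B" using wAB by (metis obox.expand vec_eq_iff)
  qed
  moreover have "code ` \<A> \<subseteq> I \<times> I \<times> UNIV"
  proof -
    have "cell A i \<in> I" if A: "A \<in> \<A>" for A i
    proof -
      have "dist (K *\<^sub>R u A) (K *\<^sub>R u A\<^sub>0) \<le> 2 * R"
        using u[OF A] u[OF A0] by (smt (verit) dist_commute dist_triangle)
      then have "dist (u A) (u A\<^sub>0) \<le> 2 * R / K"
        using assms(2) by (simp add: scale pos_le_divide_eq mult.commute)
      then have "M * dist (u A) (u A\<^sub>0) \<le> M * (2 * R / K)"
        using assms(1) by (intro mult_left_mono) auto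
      then have "dist (\<phi> (u A)) (\<phi> (u A\<^sub>0)) \<le> M * (2 * R / K)"
        using bl u A A0 by (meson order_trans)
      then have "\<bar>(\<phi> (u A) - \<phi> (u A\<^sub>0)) $ i\<bar> \<le> M * (2 * R / K)"
        using component_le_norm_cart order_trans unfolding dist_norm by blast
      then have "\<bar>(\<phi> (u A) - \<phi> (u A\<^sub>0)) $ i\<bar> / \<delta> \<le> M * (2 * R / K) / \<delta>"
        by (rule divide_right_mono) (use \<open>0 < \<delta>\<close> in simp)
      also have "\<dots> = T"
      proof -
        have "M \<noteq> 0" "K \<noteq> 0" "w \<noteq> 0" using assms(1,2) \<open>0 < w\<close> by auto
        then show ?thesis by (simp add: \<delta>_def T_def power2_eq_square)
      qed
      finally have "\<bar>(\<phi> (u A) $ i - \<phi> (u A\<^sub>0) $ i) / \<delta>\<bar> \<le> T"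
        using \<open>0 < \<delta>\<close> by (simp add: abs_divide)
      then show ?thesis unfolding cell_def I_def atLeastAtMost_iff by linarith
    qed
    then show ?thesis by (auto simp: code_def)
  qed
  ultimately have "card \<A> \<le> card (I \<times> I \<times> (UNIV :: 3 set set))"
    by (rule card_inj_on_le) (auto simp: I_def)
  also have "\<dots> = 8 * (card I)\<^sup>2"
    by (simp add: card_cartesian_product card_UNIV_set power2_eq_square)
  finally have "real (card \<A>) \<le> 8 * (real (card I))\<^sup>2"
    using of_nat_mono[where 'a = real] by fastforce
  moreover have "real (card I) \<le> 11 * (M\<^sup>2 * (R / w))"
  proof -
    have "1 * 1 \<le> M\<^sup>2 * (R / w)"
      using assms(1,4) \<open>0 < w\<close> by (intro mult_mono) auto
    then have T: "4 \<le> T" by (simp add: T_def)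
    then have "real (card I) = 2 * real_of_int \<lceil>T\<rceil> + 1" by (simp add: I_def)
    then have "real (card I) \<le> 11 / 4 * T" using T by linarith
    also have "\<dots> = 11 * (M\<^sup>2 * (R / w))" by (simp add: T_def)
    finally show ?thesis .
  qed
  then have "(real (card I))\<^sup>2 \<le> (11 * (M\<^sup>2 * (R / w)))\<^sup>2"
    by (intro power_mono) auto
  moreover have "(11 * (M\<^sup>2 * (R / w)))\<^sup>2 = 121 * (M\<^sup>2 * (R / w))\<^sup>2"
    by (subst power_mult_distrib) simp
  ultimately show ?thesis by linarith
qed simp

text \<open>The form in which the dimension of the surface enters all that follows. The constant does not
depend on \<open>K\<close>, since both the dilation and the box width scale with it.\<close>

lemma surface_box_count:
  assumes "surface S"
  obtains C :: real where "0 < C" and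
    "\<And>K l R y \<A>. \<lbrakk>0 < K; K / 2 ^ l \<le> R; \<A> \<subseteq> level_boxes K l;
       \<forall>A\<in>\<A>. \<exists>x\<in>cube A. x \<in> (\<lambda>x. K *\<^sub>R x) ` S \<and> dist x y \<le> R\<rbrakk>
      \<Longrightarrow> real (card \<A>) \<le> C * (R / (K / 2 ^ l))\<^sup>2"
proof -
  obtain \<U> M where \<U>: "finite \<U>" "S \<subseteq> \<Union>\<U>" "1 \<le> M"
    "\<And>U. U \<in> \<U> \<Longrightarrow> planar_bilipschitz M U"
    using surface_bilipschitz_cover[OF assms] by metis
  define C where "C = real (card \<U> + 1) * (968 * M ^ 4)"
  have "0 < C" using \<U>(3) by (simp add: C_def)
  moreover have "real (card \<A>) \<le> C * (R / (K / 2 ^ l))\<^sup>2"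
    if K: "0 < K" "K / 2 ^ l \<le> R" and lev: "\<A> \<subseteq> level_boxes K l" and
      meets: "\<forall>A\<in>\<A>. \<exists>x\<in>cube A. x \<in> (\<lambda>x. K *\<^sub>R x) ` S \<and> dist x y \<le> R"
    for K l R y \<A>
  proof -
    define part where "part U = {A\<in>\<A>. \<exists>u\<in>U. K *\<^sub>R u \<in> cube A \<and> dist (K *\<^sub>R u) y \<le> R}" for U
    have "finite \<A>" using lev finite_level_boxes finite_subset by blast
    have "\<A> \<subseteq> (\<Union>U\<in>\<U>. part U)"
    proof
      fix A assume "A \<in> \<A>"
      then obtain u where "u \<in> S" "K *\<^sub>R u \<in> cube A" "dist (K *\<^sub>R u) y \<le> R"
        using meets by blast
      then show "A \<in> (\<Union>U\<in>\<U>. part U)"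
        using \<U>(2) \<open>A \<in> \<A>\<close> unfolding part_def by blast
    qed
    then have "card \<A> \<le> card (\<Union>U\<in>\<U>. part U)"
      using \<U>(1) \<open>finite \<A>\<close> by (intro card_mono) (auto simp: part_def)
    also have "\<dots> \<le> (\<Sum>U\<in>\<U>. card (part U))"
      using \<U>(1) by (rule card_UN_le)
    finally have "real (card \<A>) \<le> (\<Sum>U\<in>\<U>. real (card (part U)))"
      by (metis of_nat_le_iff of_nat_sum)
    also have "\<dots> \<le> (\<Sum>U\<in>\<U>. 968 * M ^ 4 * (R / (K / 2 ^ l))\<^sup>2)"
    proof (rule sum_mono)
      fix U assume "U \<in> \<U>"
      then have "real (card (part U)) \<le> 968 * (M\<^sup>2 * (R / (K / 2 ^ l)))\<^sup>2"
        using lev by (intro bilipschitz_piece_box_count[OF \<U>(3) K(1) refl K(2) \<U>(4), of U _ y])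
          (auto simp: part_def)
      then show "real (card (part U)) \<le> 968 * M ^ 4 * (R / (K / 2 ^ l))\<^sup>2"
        by (simp only: power_mult_distrib mult.assoc flip: power_mult) simp
    qed
    also have "\<dots> \<le> C * (R / (K / 2 ^ l))\<^sup>2"
      unfolding C_def by (simp add: algebra_simps)
    finally show ?thesis .
  qed
  ultimately show ?thesis by (rule that)
qed

section \<open>Boxes and directions of the algorithm\<close>

text \<open>A member of the interaction list lies in a cube of the near field of a parent \<open>P\<close> of \<open>B\<close>, whose
radius is \<open>3w\<^sup>2\<close>. The diameter of that cube and the distance between the two centres add terms linear
in \<open>w\<close>, which \<open>w \<ge> 1\<close> absorbs into the quadratic one.\<close>

lemma interaction_list_near_centre:
  assumes A: "A \<in> interaction_list K X B" and "1 \<le> width B" and x: "x \<in> cube A"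
  shows "dist x (centre B) \<le> 11 * (width B)\<^sup>2"
proof -
  define w where "w = width B"
  have "1 \<le> w" using assms(2) by (simp add: w_def)
  obtain P Q where PQ: "B \<in> children P" "Q \<in> near_field K P" "A \<in> children Q"
    using A unfolding interaction_list_def by blast
  obtain s where s: "\<forall>i. s $ i = 1 \<or> s $ i = -1"
    "B = OBox (centre P + (width P / 4) *\<^sub>R s) (width P / 2)"
    using PQ(1) by (auto simp: children_def)
  have wP: "width P = 2 * w" using s(2) by (simp add: w_def)
  have "\<bar>(centre P - centre B) $ i\<bar> \<le> w / 2" for i
  proof -
    have "(centre P - centre B) $ i = - (w / 2) * s $ i"
      using arg_cong[OF s(2), of centre] by (simp add: wP)
    then show ?thesis using s(1)[rule_format, of i] \<open>1 \<le> w\<close> by auto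
  qed
  then have PB: "dist (centre P) (centre B) \<le> 3 * (w / 2)"
    unfolding dist_norm by (rule norm_le_three_times)
  obtain v where v: "v \<in> cube Q" "dist v (centre P) \<le> 3 * (2 * w)\<^sup>2 / 4"
    and wQ: "width Q = 2 * w"
    using PQ(2) unfolding near_field_def wP by auto
  have "x \<in> cube Q"
    using child_cube_subset[OF PQ(3)] x wQ \<open>1 \<le> w\<close> by auto
  have "\<bar>(x - v) $ i\<bar> \<le> 2 * w" for i
    using v(1)[unfolded mem_cube wQ, rule_format, of i]
      \<open>x \<in> cube Q\<close>[unfolded mem_cube wQ, rule_format, of i] by simp
  then have "dist x v \<le> 3 * (2 * w)"
    unfolding dist_norm by (rule norm_le_three_times)
  then have "dist x (centre B) \<le> 6 * w + 3 * w\<^sup>2 + 3 * (w / 2)"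
    using dist_triangle[of x "centre B" v] dist_triangle[of v "centre B" "centre P"] v(2) PB
    by (simp add: power_mult_distrib)
  also have "\<dots> \<le> 11 * w\<^sup>2"
    using mult_left_mono[of 1 w w] \<open>1 \<le> w\<close> by (simp add: power2_eq_square)
  finally show ?thesis by (simp add: w_def)
qed

text \<open>The radius \<open>O(w\<^sup>2)\<close> over the width \<open>w\<close> leaves a ratio \<open>O(w)\<close>, whose square bounds the count. This is
the same order as the number of directions of the box.\<close>

lemma interaction_list_count:
  assumes "surface S"
  obtains C :: real where "0 < C" and
    "\<And>K X B. \<lbrakk>0 < K; X \<subseteq> (\<lambda>x. K *\<^sub>R x) ` S; B \<in> all_boxes K; 1 \<le> width B\<rbrakk>
      \<Longrightarrow> finite (interaction_list K X B) \<and>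
         real (card (interaction_list K X B)) \<le> C * (width B)\<^sup>2"
proof -
  obtain C where C: "0 < C" "\<And>K l R y \<A>. \<lbrakk>0 < K; K / 2 ^ l \<le> R; \<A> \<subseteq> level_boxes K l;
       \<forall>A\<in>\<A>. \<exists>x\<in>cube A. x \<in> (\<lambda>x. K *\<^sub>R x) ` S \<and> dist x y \<le> R\<rbrakk>
      \<Longrightarrow> real (card \<A>) \<le> C * (R / (K / 2 ^ l))\<^sup>2"
    using surface_box_count[OF assms] by blast
  have "finite (interaction_list K X B) \<and>
        real (card (interaction_list K X B)) \<le> 121 * C * (width B)\<^sup>2"
    if K: "0 < K" and X: "X \<subseteq> (\<lambda>x. K *\<^sub>R x) ` S" and B: "B \<in> all_boxes K" "1 \<le> width B"
    for K X B
  proof -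
    obtain l where l: "B \<in> level_boxes K l" using B(1) by (auto simp: all_boxes_def)
    have w: "width B = K / 2 ^ l" using width_level_boxes[OF l] .
    have sub: "interaction_list K X B \<subseteq> level_boxes K l"
    proof
      fix A assume A: "A \<in> interaction_list K X B"
      then obtain k where k: "A \<in> level_boxes K k"
        using octree_subset_all_boxes by (fastforce simp: interaction_list_def all_boxes_def)
      have "K / 2 ^ k = K / 2 ^ l"
        using A width_level_boxes[OF k] w by (simp add: interaction_list_def)
      then have "(2::real) ^ k = 2 ^ l" using K by simp
      then show "A \<in> level_boxes K l" using k by simp
    qed
    have "width B * 1 \<le> width B * (11 * width B)"
      using B(2) by (intro mult_left_mono) auto
    then have R: "K / 2 ^ l \<le> 11 * (width B)\<^sup>2"
      by (simp add: w[symmetric] power2_eq_square)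
    have "\<forall>A\<in>interaction_list K X B. \<exists>x\<in>cube A.
        x \<in> (\<lambda>x. K *\<^sub>R x) ` S \<and> dist x (centre B) \<le> 11 * (width B)\<^sup>2"
    proof
      fix A assume A: "A \<in> interaction_list K X B"
      then obtain x where "x \<in> X" "x \<in> cube A"
        by (auto simp: interaction_list_def nonempty_box_def)
      then show "\<exists>x\<in>cube A. x \<in> (\<lambda>x. K *\<^sub>R x) ` S \<and> dist x (centre B) \<le> 11 * (width B)\<^sup>2"
        using X interaction_list_near_centre[OF A B(2)] by blast
    qed
    from C(2)[OF K R sub this]
    have "real (card (interaction_list K X B)) \<le> C * (11 * (width B)\<^sup>2 / width B)\<^sup>2"
      by (simp only: w)
    also have "\<dots> = 121 * C * (width B)\<^sup>2"
      using B(2) by (simp add: power2_eq_square)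
    finally show ?thesis
      using sub finite_level_boxes finite_subset by blast
  qed
  then show ?thesis using C(1) that[of "121 * C"] by simp
qed

lemma hf_boxes_all_boxes: "B \<in> hf_boxes K X \<Longrightarrow> B \<in> all_boxes K"
  using octree_subset_all_boxes by (auto simp: hf_boxes_def)

lemma sum_UN_le_sum:
  fixes f :: "'a \<Rightarrow> real"
  assumes "finite I" and "\<And>i. finite (A i)" and "\<And>x. 0 \<le> f x"
  shows "sum f (\<Union>i\<in>I. A i) \<le> (\<Sum>i\<in>I. sum f (A i))"
  using assms(1)
proof induction
  case (insert i I)
  have "sum f (A i \<union> (\<Union>i\<in>I. A i)) + sum f (A i \<inter> (\<Union>i\<in>I. A i))
      = sum f (A i) + sum f (\<Union>i\<in>I. A i)"
    using insert.hyps(1) assms(2) by (intro sum.union_inter) auto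
  moreover have "0 \<le> sum f (A i \<inter> (\<Union>i\<in>I. A i))"
    using assms(3) by (rule sum_nonneg)
  ultimately show ?case using insert by simp
qed simp

text \<open>On each level the factors \<open>(K/w)\<^sup>2\<close> for the boxes and \<open>w\<^sup>2\<close> for the directions of a box cancel, so
all levels contribute equally and only the number of levels remains to be counted.\<close>

lemma direction_system_count:
  assumes "surface S" and "S \<subseteq> cball 0 (1/2)" and "0 < d\<^sub>2"
  obtains C :: real where "0 < C" and
    "\<And>L K X D W d\<^sub>1 \<alpha>. \<lbrakk>K = 2 ^ (2 * L); X \<subseteq> (\<lambda>x. K *\<^sub>R x) ` S; direction_system d\<^sub>1 d\<^sub>2 \<alpha> K D W\<rbrakk>
      \<Longrightarrow> finite (hf_boxes K X) \<and>
         (\<Sum>B\<in>hf_boxes K X. real (card (D B))) \<le> C * (2 * real L + 1) * K\<^sup>2"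
proof -
  obtain C where C: "0 < C" "\<And>K l R y \<A>. \<lbrakk>0 < K; K / 2 ^ l \<le> R; \<A> \<subseteq> level_boxes K l;
       \<forall>A\<in>\<A>. \<exists>x\<in>cube A. x \<in> (\<lambda>x. K *\<^sub>R x) ` S \<and> dist x y \<le> R\<rbrakk>
      \<Longrightarrow> real (card \<A>) \<le> C * (R / (K / 2 ^ l))\<^sup>2"
    using surface_box_count[OF assms(1)] by blast
  have "finite (hf_boxes K X) \<and>
        (\<Sum>B\<in>hf_boxes K X. real (card (D B))) \<le> (C * d\<^sub>2) * (2 * real L + 1) * K\<^sup>2"
    if KL: "K = 2 ^ (2 * L)" and X: "X \<subseteq> (\<lambda>x. K *\<^sub>R x) ` S"
      and dir: "direction_system d\<^sub>1 d\<^sub>2 \<alpha> K D W" for L K X D W d\<^sub>1 \<alpha>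
  proof -
    have "0 < K" using KL by simp
    define Lev where "Lev l = hf_boxes K X \<inter> level_boxes K l" for l
    have fin: "finite (Lev l)" for l by (simp add: Lev_def finite_level_boxes)
    have sub: "hf_boxes K X \<subseteq> (\<Union>l\<le>2 * L. Lev l)"
    proof
      fix B assume B: "B \<in> hf_boxes K X"
      then obtain l where l: "B \<in> level_boxes K l"
        using hf_boxes_all_boxes[OF B] by (auto simp: all_boxes_def)
      have "1 \<le> K / 2 ^ l"
        using B width_level_boxes[OF l] by (simp add: hf_boxes_def)
      then have "(2::real) ^ l \<le> 2 ^ (2 * L)" by (simp add: KL)
      then have "l \<le> 2 * L" by (rule power_le_imp_le_exp[rotated]) simp
      then show "B \<in> (\<Union>l\<le>2 * L. Lev l)" using B l by (auto simp: Lev_def)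
    qed
    have lev: "(\<Sum>B\<in>Lev l. real (card (D B))) \<le> C * d\<^sub>2 * K\<^sup>2" for l
    proof -
      let ?w = "K / 2 ^ l"
      have "K / 2 ^ l \<le> K / 1" using \<open>0 < K\<close> by (intro divide_left_mono) auto
      then have wK: "?w \<le> K" by simp
      have "Lev l \<subseteq> level_boxes K l" by (auto simp: Lev_def)
      moreover have "\<forall>A\<in>Lev l. \<exists>x\<in>cube A. x \<in> (\<lambda>x. K *\<^sub>R x) ` S \<and> dist x 0 \<le> K"
      proof
        fix A assume "A \<in> Lev l"
        then obtain x where x: "x \<in> X" "x \<in> cube A"
          by (auto simp: Lev_def hf_boxes_def nonempty_box_def)
        then obtain s where s: "s \<in> S" "x = K *\<^sub>R s" using X by blast
        then have "norm s \<le> 1" using assms(2) by force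
        then have "K * norm s \<le> K * 1"
          using \<open>0 < K\<close> by (intro mult_left_mono) auto
        then have "dist x 0 \<le> K" using s(2) \<open>0 < K\<close> by simp
        then show "\<exists>x\<in>cube A. x \<in> (\<lambda>x. K *\<^sub>R x) ` S \<and> dist x 0 \<le> K"
          using x s by blast
      qed
      ultimately have card: "real (card (Lev l)) \<le> C * (K / ?w)\<^sup>2"
        by (rule C(2)[OF \<open>0 < K\<close> wK])
      have "real (card (D B)) \<le> d\<^sub>2 * ?w\<^sup>2" if B: "B \<in> Lev l" for B
      proof -
        have "B \<in> all_boxes K" "1 \<le> width B" "width B \<le> sqrt K"
          using B hf_boxes_all_boxes by (auto simp: Lev_def hf_boxes_def)
        then have "real (card (D B)) \<le> d\<^sub>2 * (width B)\<^sup>2"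
          using dir unfolding direction_system_def by blast
        moreover have "width B = ?w"
          using B width_level_boxes by (auto simp: Lev_def)
        ultimately show ?thesis by simp
      qed
      then have "(\<Sum>B\<in>Lev l. real (card (D B))) \<le> real (card (Lev l)) * (d\<^sub>2 * ?w\<^sup>2)"
        using sum_bounded_above[of "Lev l" "\<lambda>B. real (card (D B))"] by simp
      also have "\<dots> \<le> C * (K / ?w)\<^sup>2 * (d\<^sub>2 * ?w\<^sup>2)"
        using card assms(3) by (intro mult_right_mono) auto
      also have "\<dots> = C * d\<^sub>2 * K\<^sup>2"
        using \<open>0 < K\<close> by (simp add: power_divide)
      finally show ?thesis .
    qed
    have "(\<Sum>B\<in>hf_boxes K X. real (card (D B))) \<le> (\<Sum>B\<in>(\<Union>l\<le>2 * L. Lev l). real (card (D B)))"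
      using sub fin by (intro sum_mono2) auto
    also have "\<dots> \<le> (\<Sum>l\<le>2 * L. \<Sum>B\<in>Lev l. real (card (D B)))"
      using fin by (intro sum_UN_le_sum) auto
    also have "\<dots> \<le> (\<Sum>l\<le>2 * L. C * d\<^sub>2 * K\<^sup>2)"
      by (intro sum_mono lev)
    also have "\<dots> = (C * d\<^sub>2) * (2 * real L + 1) * K\<^sup>2"
      by (simp add: algebra_simps)
    finally show ?thesis
      using sub fin finite_subset by (metis (no_types, lifting) finite_UN finite_atMost)
  qed
  then show ?thesis using C(1) assms(3) that[of "C * d\<^sub>2"] by simp
qed

section \<open>Work of one process\<close>

lemma process_directions_Sigma:
  "process_directions K X D \<P> q = Sigma {B \<in> hf_boxes K X. \<P> B = q} D"
  by (auto simp: process_directions_def)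

lemma sum_children_le:
  fixes f :: "obox \<Rightarrow> nat"
  assumes "\<And>C. f C \<le> \<kappa>"
  shows "(\<Sum>C\<in>{C \<in> children B. nonempty_box X C}. f C) \<le> 8 * \<kappa>"
proof -
  have "card {C \<in> children B. nonempty_box X C} \<le> card (children B)"
    using finite_card_children by (intro card_mono) auto
  then have "card {C \<in> children B. nonempty_box X C} \<le> 8"
    using finite_card_children le_trans by blast
  then have "card {C \<in> children B. nonempty_box X C} * \<kappa> \<le> 8 * \<kappa>" by simp
  moreover have "(\<Sum>C\<in>{C \<in> children B. nonempty_box X C}. f C)
      \<le> card {C \<in> children B. nonempty_box X C} * \<kappa>"
    using sum_bounded_above[of _ f \<kappa>] assms by simp
  ultimately show ?thesis by (rule le_trans[rotated])
qed

lemma sum_card_fibres_le: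
  assumes "finite I" and "finite J"
  shows "(\<Sum>l\<in>J. card {A \<in> I. g A = l}) \<le> card I"
proof -
  have "(\<Sum>l\<in>J. card {A \<in> I. g A = l}) = card (\<Union>l\<in>J. {A \<in> I. g A = l})"
    using assms by (intro card_UN_disjoint[symmetric]) auto
  also have "\<dots> \<le> card I"
    using assms(1) by (intro card_mono) auto
  finally show ?thesis .
qed

text \<open>
For fixed \<open>B\<close>, summing the M2L translations over all directions counts every box of the interaction
list at most once, whatever the distribution of the list over the directions. The hypothesis on \<open>c\<close>
compares the length of the list with the number of directions, and thereby spreads its cost evenly
over the pairs of \<open>B\<close>.
\<close>

lemma hf_operations_le_process_directions:
  assumes "finite (hf_boxes K X)" and "0 \<le> c"
    and D: "\<And>B. B \<in> hf_boxes K X \<Longrightarrow> finite (D B) \<and> finite (interaction_list K X B) \<and>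
          real (card (interaction_list K X B)) \<le> c * real (card (D B))"
    and ops: "\<And>B l C. m2m B l C \<le> \<kappa> \<and> m2l B l C \<le> \<kappa> \<and> l2l B l C \<le> \<kappa>"
  shows "real (hf_operations K X D dir \<P> m2m m2l l2l q)
           \<le> real \<kappa> * (16 + c) * real (card (process_directions K X D \<P> q))"
proof -
  define H where "H = {B \<in> hf_boxes K X. \<P> B = q}"
  have H: "finite H" "\<And>B. B \<in> H \<Longrightarrow> B \<in> hf_boxes K X" using assms(1) by (auto simp: H_def)
  define n where "n B l = card {A \<in> interaction_list K X B. dir B A = l}" for B l
  have single: "(\<Sum>C\<in>{C \<in> children B. nonempty_box X C}. m2m B l C) +
        (\<Sum>A\<in>{A \<in> interaction_list K X B. dir B A = l}. m2l B l A) +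
        (\<Sum>C\<in>{C \<in> children B. nonempty_box X C}. l2l B l C) \<le> 16 * \<kappa> + n B l * \<kappa>" for B l
  proof -
    have "(\<Sum>A\<in>{A \<in> interaction_list K X B. dir B A = l}. m2l B l A) \<le> n B l * \<kappa>"
      unfolding n_def using sum_bounded_above[of _ "m2l B l" \<kappa>] ops by simp
    moreover have "(\<Sum>C\<in>{C \<in> children B. nonempty_box X C}. m2m B l C) \<le> 8 * \<kappa>"
      "(\<Sum>C\<in>{C \<in> children B. nonempty_box X C}. l2l B l C) \<le> 8 * \<kappa>"
      using ops by (auto intro!: sum_children_le)
    ultimately show ?thesis by linarith
  qed
  have "hf_operations K X D dir \<P> m2m m2l l2l q
      \<le> (\<Sum>(B, l)\<in>Sigma H D. 16 * \<kappa> + n B l * \<kappa>)"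
    unfolding hf_operations_def process_directions_Sigma H_def[symmetric]
    by (rule sum_mono) (use single in auto)
  also have "\<dots> = (\<Sum>B\<in>H. \<Sum>l\<in>D B. 16 * \<kappa> + n B l * \<kappa>)"
    using H D by (intro sum.Sigma[symmetric]) auto
  finally have "real (hf_operations K X D dir \<P> m2m m2l l2l q)
      \<le> real (\<Sum>B\<in>H. \<Sum>l\<in>D B. 16 * \<kappa> + n B l * \<kappa>)"
    by (rule of_nat_mono)
  also have "\<dots> = (\<Sum>B\<in>H. real (\<Sum>l\<in>D B. 16 * \<kappa> + n B l * \<kappa>))"
    by (rule of_nat_sum)
  also have "\<dots> \<le> (\<Sum>B\<in>H. real \<kappa> * (16 + c) * real (card (D B)))"
  proof (rule sum_mono)
    fix B assume "B \<in> H"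
    then have DB: "finite (D B)" "finite (interaction_list K X B)"
      "real (card (interaction_list K X B)) \<le> c * real (card (D B))"
      using D H(2) by blast+
    have "(\<Sum>l\<in>D B. n B l) \<le> card (interaction_list K X B)"
      unfolding n_def by (rule sum_card_fibres_le[OF DB(2,1)])
    then have "real (\<Sum>l\<in>D B. n B l) \<le> c * real (card (D B))"
      using DB(3) by linarith
    then have "real (\<Sum>l\<in>D B. n B l) * real \<kappa> \<le> c * real (card (D B)) * real \<kappa>"
      by (rule mult_right_mono) simp
    moreover have "(\<Sum>l\<in>D B. 16 * \<kappa> + n B l * \<kappa>) = 16 * \<kappa> * card (D B) + (\<Sum>l\<in>D B. n B l) * \<kappa>"
      by (simp add: sum.distrib sum_distrib_right)
    ultimately show "real (\<Sum>l\<in>D B. 16 * \<kappa> + n B l * \<kappa>) \<le> real \<kappa> * (16 + c) * real (card (D B))"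
      by (simp add: algebra_simps del: of_nat_sum)
  qed
  also have "\<dots> = real \<kappa> * (16 + c) * real (card (Sigma H D))"
    using H D by (simp add: card_SigmaI sum_distrib_left)
  finally show ?thesis
    by (simp add: process_directions_Sigma H_def)
qed

lemma equal_share_of_directions:
  assumes "finite (hf_boxes K X)" and "\<And>B. B \<in> hf_boxes K X \<Longrightarrow> finite (D B)" and "q < p"
    and equal: "\<forall>q<p. \<forall>r<p. card (process_directions K X D \<P> q) = card (process_directions K X D \<P> r)"
  shows "real p * real (card (process_directions K X D \<P> q)) \<le> (\<Sum>B\<in>hf_boxes K X. real (card (D B)))"
proof -
  have fin: "finite (Sigma (hf_boxes K X) D)"
    using assms(1,2) by (intro finite_SigmaI) auto
  have sub: "process_directions K X D \<P> r \<subseteq> Sigma (hf_boxes K X) D" for r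
    by (auto simp: process_directions_def)
  have "p * card (process_directions K X D \<P> q) = (\<Sum>r<p. card (process_directions K X D \<P> q))"
    by simp
  also have "\<dots> = (\<Sum>r<p. card (process_directions K X D \<P> r))"
    by (rule sum.cong[OF refl]) (use equal assms(3) in blast)
  also have "\<dots> = card (\<Union>r<p. process_directions K X D \<P> r)"
    using finite_subset[OF sub fin]
    by (intro card_UN_disjoint[symmetric]) (auto simp: process_directions_def)
  also have "\<dots> \<le> card (Sigma (hf_boxes K X) D)"
    using fin sub by (intro card_mono) auto
  also have "\<dots> = (\<Sum>B\<in>hf_boxes K X. card (D B))"
    using assms(1,2) by (intro card_SigmaI) auto
  finally show ?thesis
    by (metis of_nat_le_iff of_nat_mult of_nat_sum)
qed

text \<open>The condition \<open>2 \<le> N\<close> keeps \<open>ln N\<close> away from zero, so that for \<open>a < 1\<close> the summand \<open>ln a\<close>, which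
is negative, can be absorbed into a multiple of \<open>ln N\<close>.\<close>

lemma levels_le_ln:
  assumes "0 < (a::real)"
  obtains c :: real where "0 < c" and
    "\<And>L N. \<lbrakk>2 \<le> N; a * (2 ^ (2 * L))\<^sup>2 \<le> real N\<rbrakk> \<Longrightarrow> real L \<le> c * ln (real N)"
proof -
  define c where "c = (1 + \<bar>ln a\<bar> / ln 2) / (4 * ln 2)"
  have c: "0 < c"
    unfolding c_def by (intro divide_pos_pos add_pos_nonneg) auto
  have "real L \<le> c * ln (real N)"
    if N: "2 \<le> N" "a * (2 ^ (2 * L))\<^sup>2 \<le> real N" for L N :: nat
  proof -
    have "ln (a * (2 ^ (2 * L))\<^sup>2) \<le> ln (real N)"
      using N assms by (subst ln_le_cancel_iff) auto
    also have "ln (a * (2 ^ (2 * L))\<^sup>2) = ln a + 4 * real L * ln 2"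
      using assms by (simp add: ln_mult ln_realpow)
    finally have "4 * real L * ln 2 \<le> ln (real N) + \<bar>ln a\<bar>" by linarith
    moreover have "ln 2 \<le> ln (real N)" using N(1) by simp
    then have "\<bar>ln a\<bar> / ln 2 * ln 2 \<le> \<bar>ln a\<bar> / ln 2 * ln (real N)"
      by (intro mult_left_mono) auto
    then have "\<bar>ln a\<bar> \<le> \<bar>ln a\<bar> / ln 2 * ln (real N)" by simp
    ultimately have "real L * (4 * ln 2) \<le> (1 + \<bar>ln a\<bar> / ln 2) * ln (real N)"
      by (simp add: algebra_simps)
    then show ?thesis by (simp add: c_def field_simps)
  qed
  then show ?thesis using c that by blast
qed

theorem proposition3p3:
  fixes S :: "(real^3) set" and \<gamma> a b d\<^sub>1 d\<^sub>2 \<alpha> :: real and \<kappa> :: nat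
  assumes "surface S" and "S \<subseteq> cball 0 (1/2)"
    and "0 < \<gamma>" and "0 < a" and "0 < b" and "0 < d\<^sub>1" and "0 < d\<^sub>2" and "0 < \<alpha>"
  shows "\<exists>Const :: real. \<forall>(L :: nat) (K :: real) (N :: nat) (pts :: nat \<Rightarrow> real^3) (X :: (real^3) set)
      (D :: obox \<Rightarrow> nat set) (W :: obox \<Rightarrow> nat \<Rightarrow> (real^3) set) (dir :: obox \<Rightarrow> obox \<Rightarrow> nat)
      (p :: nat) (\<P> :: obox \<Rightarrow> nat) m2m m2l l2l.
      0 < L \<and> K = 2 ^ (2 * L) \<and>
      2 \<le> N \<and> a * K\<^sup>2 \<le> real N \<and> real N \<le> b * K\<^sup>2 \<and>
      X = pts ` {1..N} \<and> quasi_uniform \<gamma> X ((\<lambda>x. K *\<^sub>R x) ` S) \<and>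
      direction_system d\<^sub>1 d\<^sub>2 \<alpha> K D W \<and> direction_assignment K X D W dir \<and>
      0 < p \<and> process_partition K X p \<P> \<and>
      (\<forall>B l C. m2m B l C \<le> \<kappa> \<and> m2l B l C \<le> \<kappa> \<and> l2l B l C \<le> \<kappa>) \<and>
      (\<forall>q<p. \<forall>r<p. card (process_directions K X D \<P> q) = card (process_directions K X D \<P> r))
      \<longrightarrow> real (Max ((\<lambda>q. hf_operations K X D dir \<P> m2m m2l l2l q) ` {..<p}))
            \<le> Const * (real N * ln (real N) / real p)"
proof -
  obtain C\<^sub>I where CI: "0 < C\<^sub>I"
    "\<And>K X B. \<lbrakk>0 < K; X \<subseteq> (\<lambda>x. K *\<^sub>R x) ` S; B \<in> all_boxes K; 1 \<le> width B\<rbrakk>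
      \<Longrightarrow> finite (interaction_list K X B) \<and>
         real (card (interaction_list K X B)) \<le> C\<^sub>I * (width B)\<^sup>2"
    using interaction_list_count[OF assms(1)] by blast
  obtain C\<^sub>D where CD: "0 < C\<^sub>D"
    "\<And>L K X D W d\<^sub>1 \<alpha>. \<lbrakk>K = 2 ^ (2 * L); X \<subseteq> (\<lambda>x. K *\<^sub>R x) ` S; direction_system d\<^sub>1 d\<^sub>2 \<alpha> K D W\<rbrakk>
      \<Longrightarrow> finite (hf_boxes K X) \<and>
         (\<Sum>B\<in>hf_boxes K X. real (card (D B))) \<le> C\<^sub>D * (2 * real L + 1) * K\<^sup>2"
    using direction_system_count[OF assms(1,2,7)] by blast
  obtain c where c: "0 < c"
    "\<And>L N. \<lbrakk>2 \<le> N; a * (2 ^ (2 * L))\<^sup>2 \<le> real N\<rbrakk> \<Longrightarrow> real L \<le> c * ln (real N)"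
    using levels_le_ln[OF assms(4)] by blast
  define A where "A = real \<kappa> * (16 + C\<^sub>I / d\<^sub>1)"
  have "0 \<le> A" using CI(1) assms(6) by (simp add: A_def)
  show ?thesis
  proof (intro exI[of _ "A * (C\<^sub>D * (3 * c) / a)"] allI impI, elim conjE)
    fix L N p :: nat and K :: real and pts :: "nat \<Rightarrow> real^3" and X :: "(real^3) set"
      and D :: "obox \<Rightarrow> nat set" and W :: "obox \<Rightarrow> nat \<Rightarrow> (real^3) set"
      and dir :: "obox \<Rightarrow> obox \<Rightarrow> nat" and \<P> :: "obox \<Rightarrow> nat"
      and m2m m2l l2l :: "obox \<Rightarrow> nat \<Rightarrow> obox \<Rightarrow> nat"
    assume L: "0 < L" and K: "K = 2 ^ (2 * L)" and N: "2 \<le> N" "a * K\<^sup>2 \<le> real N"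
      and qu: "quasi_uniform \<gamma> X ((\<lambda>x. K *\<^sub>R x) ` S)"
      and ds: "direction_system d\<^sub>1 d\<^sub>2 \<alpha> K D W" and p: "0 < p"
      and ops: "\<forall>B l C. m2m B l C \<le> \<kappa> \<and> m2l B l C \<le> \<kappa> \<and> l2l B l C \<le> \<kappa>"
      and equal: "\<forall>q<p. \<forall>r<p. card (process_directions K X D \<P> q) = card (process_directions K X D \<P> r)"
    have X: "X \<subseteq> (\<lambda>x. K *\<^sub>R x) ` S" using qu by (simp add: quasi_uniform_def)
    have "0 < K" using K by simp
    have hf: "finite (hf_boxes K X)"
      and total: "(\<Sum>B\<in>hf_boxes K X. real (card (D B))) \<le> C\<^sub>D * (2 * real L + 1) * K\<^sup>2"
      using CD(2)[OF K X ds] by auto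
    have box: "finite (D B) \<and> finite (interaction_list K X B) \<and>
          real (card (interaction_list K X B)) \<le> C\<^sub>I / d\<^sub>1 * real (card (D B))"
      if B: "B \<in> hf_boxes K X" for B
    proof -
      have B': "B \<in> all_boxes K" "1 \<le> width B" "width B \<le> sqrt K"
        using B hf_boxes_all_boxes by (auto simp: hf_boxes_def)
      then have "finite (D B)" and "d\<^sub>1 * (width B)\<^sup>2 \<le> real (card (D B))"
        using ds unfolding direction_system_def by blast+
      moreover from this(2) have "C\<^sub>I / d\<^sub>1 * (d\<^sub>1 * (width B)\<^sup>2) \<le> C\<^sub>I / d\<^sub>1 * real (card (D B))"
        using CI(1) assms(6) by (intro mult_left_mono) auto
      then have "C\<^sub>I * (width B)\<^sup>2 \<le> C\<^sub>I / d\<^sub>1 * real (card (D B))"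
        using assms(6) by simp
      ultimately show ?thesis
        using CI(2)[OF \<open>0 < K\<close> X B'(1,2)] by linarith
    qed
    have "C\<^sub>D * (2 * real L + 1) * K\<^sup>2 \<le> C\<^sub>D * (3 * c) / a * (real N * ln (real N))"
    proof -
      have "2 * real L + 1 \<le> 3 * c * ln (real N)"
        using c(2)[OF N(1), of L] N(2) K L by simp
      moreover have "K\<^sup>2 \<le> real N / a"
        using N(2) assms(4) by (simp add: field_simps)
      moreover have "0 \<le> 3 * c * ln (real N)" using N(1) c(1) by simp
      ultimately have "(2 * real L + 1) * K\<^sup>2 \<le> (3 * c * ln (real N)) * (real N / a)"
        by (intro mult_mono) auto
      then have "C\<^sub>D * ((2 * real L + 1) * K\<^sup>2) \<le> C\<^sub>D * ((3 * c * ln (real N)) * (real N / a))"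
        using CD(1) by (intro mult_left_mono) auto
      then show ?thesis by (simp add: mult_ac)
    qed
    with total have total_N:
      "(\<Sum>B\<in>hf_boxes K X. real (card (D B))) \<le> C\<^sub>D * (3 * c) / a * (real N * ln (real N))"
      by linarith
    have bound: "real (hf_operations K X D dir \<P> m2m m2l l2l q)
        \<le> A * (C\<^sub>D * (3 * c) / a) * (real N * ln (real N) / real p)" if "q < p" for q
    proof -
      let ?n = "real (card (process_directions K X D \<P> q))"
      have "real p * ?n \<le> C\<^sub>D * (3 * c) / a * (real N * ln (real N))"
        using equal_share_of_directions[OF hf _ that equal] box total_N by fastforce
      then have "?n \<le> C\<^sub>D * (3 * c) / a * (real N * ln (real N)) / real p"
        using p by (metis mult.commute of_nat_0_less_iff pos_le_divide_eq)
      then have "A * ?n \<le> A * (C\<^sub>D * (3 * c) / a * (real N * ln (real N)) / real p)"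
        using \<open>0 \<le> A\<close> by (rule mult_left_mono)
      moreover have "real (hf_operations K X D dir \<P> m2m m2l l2l q) \<le> A * ?n"
        unfolding A_def using CI(1) assms(6) ops box
        by (intro hf_operations_le_process_directions[OF hf]) auto
      ultimately show ?thesis by simp
    qed
    have "Max ((\<lambda>q. hf_operations K X D dir \<P> m2m m2l l2l q) ` {..<p})
        \<in> (\<lambda>q. hf_operations K X D dir \<P> m2m m2l l2l q) ` {..<p}"
      using p by (intro Max_in) auto
    then show "real (Max ((\<lambda>q. hf_operations K X D dir \<P> m2m m2l l2l q) ` {..<p}))
        \<le> A * (C\<^sub>D * (3 * c) / a) * (real N * ln (real N) / real p)"
      using bound by auto
  qed
qed

end
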